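(* Let $\mathcal L$ be a spectral labeling of the infinite binary tree. For each vertex $d_0\dots d_{n-1}$, let $\mathcal L_{d_0\dots d_{n-1}}$ be the spectral labeling obtained by reading the labels in the subtree with root $d_0\dots d_{n-1}$. Suppose there exists a finite set $\mathcal S$ of infinite paths in the labeled binary tree, starting at the root $\emptyset$, that satisfy the following conditions: (i) the paths in $\mathcal S$ do not end in $\underline 0$ or $\underline 3$; (ii) for any vertex $d_0\dots d_{n-1}$ that does not lie on any of the paths in $\mathcal S$, the set $\Lambda(\mathcal L_{d_0\dots d_{n-1}})$ is a spectrum for $\mu_4$. Then $\Lambda(\mathcal L)$ is a spectrum for $\mu_4$.
   Context: Measure. $\mu_4$ is the unique Borel probability measure on $\mathbb{R}$ satisfying $\int f(x)\,d\mu_4(x)=\frac12\left(\int f(\tfrac{x}{4})\,d\mu_4(x)+\int f(\tfrac{x+2}{4})\,d\mu_4(x)\right)$ for all $f\in C_c(\mathbb{R})$. For $\lambda\in\mathbb{R}$, $e_\lambda(x):=e^{2\pi i\lambda x}$. A set $\Lambda\subset\mathbb{R}$ is a spectrum for $\mu_4$ if $\{e_\lambda:\lambda\in\Lambda\}$ is an orthonormal basis of $L^2(\mu_4)$. Base 4 expansion. For $k\in\mathbb{Z}$ put $k_0=k$ and inductively $k_n=d_n+4k_{n+1}$ with $d_n\in\{0,1,2,3\}$, $k_{n+1}\in\mathbb{Z}$. The infinite string $d_0d_1d_2\dots$ is the base 4 expansion of $k$, written $k=d_0d_1\dots$. It ends in $\underline 0=000\dots$ if $k\ge0$ and in $\underline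 3=333\dots$ if $k<0$. Conversely every infinite string over $\{0,1,2,3\}$ ending in $\underline 0$ or $\underline 3$ is the expansion of exactly one integer: $d_0\dots d_N\underline 0=\sum_{n=0}^N4^nd_n$ and $d_0\dots d_N\underline 3=\sum_{n=0}^N4^nd_n-4^{N+1}$. Spectral labeling. Let $\mathcal T$ be the complete infinite rooted binary tree (root $\emptyset$, each vertex having two outgoing edges to its two children). A spectral labeling $\mathcal L$ is a labeling of the edges of $\mathcal T$ with labels in $\{0,1,2,3\}$ such that: (i) for each vertex $v$, the two edges starting from $v$ have labels of different parity; (ii) for each vertex $v$ there exists an infinite (downward) path starting from $v$ whose edges are eventually all labeled $0$ or eventually all labeled $3$. Given a spectral labeling, each vertex is identified with the finite word $d_0\dots d_{n-1}$ of labels read along the unique path from $\emptyset$ to it, and an infinite path with the infinite word of labels read along it. Put $$\Lambda(\mathcal L):=\{k=d_0d_1\dots\in\mathbb{Z} : d_0d_1\dots\text{ is an infinite path in the tree starting from }\emptyset\text{ and ending in }\underline 0\text{ or }\underline 3\}.$$ *)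

theory Defs
  imports "HOL-Probability.Probability"
begin

text \<open>This property determines \<open>M\<close> uniquely; \<open>\<mu>\<^sub>4\<close> denotes the measure having it.
  The test functions range over the complex-valued functions in \<open>C\<^sub>c(\<real>)\<close>.\<close>

definition is_mu4 :: "real measure \<Rightarrow> bool" where
  "is_mu4 M \<longleftrightarrow> prob_space M \<and> sets M = sets borel \<and>
     (\<forall>f :: real \<Rightarrow> complex.
        continuous_on UNIV f \<longrightarrow> compact (closure {x. f x \<noteq> 0}) \<longrightarrow>
        (LINT x|M. f x) = ((LINT x|M. f (x / 4)) + (LINT x|M. f ((x + 2) / 4))) / 2)"

text \<open>Elements of \<open>L\<^sup>2(M)\<close> are represented by square integrable functions;
  the notions below do not change if such a function is modified, measurably, on a null set.\<close>

definition L2_function :: "'a measure \<Rightarrow> ('a \<Rightarrow> complex) \<Rightarrow> bool" where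
  "L2_function M f \<longleftrightarrow> f \<in> borel_measurable M \<and> integrable M (\<lambda>x. (cmod (f x))\<^sup>2)"

definition L2_inner :: "'a measure \<Rightarrow> ('a \<Rightarrow> complex) \<Rightarrow> ('a \<Rightarrow> complex) \<Rightarrow> complex" where
  "L2_inner M f g = (LINT x|M. f x * cnj (g x))"

definition L2_norm :: "'a measure \<Rightarrow> ('a \<Rightarrow> complex) \<Rightarrow> real" where
  "L2_norm M f = sqrt (LINT x|M. (cmod (f x))\<^sup>2)"

definition L2_orthonormal ::
  "'a measure \<Rightarrow> 'i set \<Rightarrow> ('i \<Rightarrow> 'a \<Rightarrow> complex) \<Rightarrow> bool" where
  "L2_orthonormal M I u \<longleftrightarrow>
     (\<forall>i\<in>I. L2_function M (u i)) \<and>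
     (\<forall>i\<in>I. \<forall>j\<in>I. L2_inner M (u i) (u j) = (if i = j then 1 else 0))"

definition L2_total ::
  "'a measure \<Rightarrow> 'i set \<Rightarrow> ('i \<Rightarrow> 'a \<Rightarrow> complex) \<Rightarrow> bool" where
  "L2_total M I u \<longleftrightarrow>
     (\<forall>f. L2_function M f \<longrightarrow>
        (\<forall>\<epsilon>>0. \<exists>F c. finite F \<and> F \<subseteq> I \<and>
           L2_norm M (\<lambda>x. f x - (\<Sum>i\<in>F. c i * u i x)) < \<epsilon>))"

definition L2_orthonormal_basis ::
  "'a measure \<Rightarrow> 'i set \<Rightarrow> ('i \<Rightarrow> 'a \<Rightarrow> complex) \<Rightarrow> bool" where
  "L2_orthonormal_basis M I u \<longleftrightarrow> L2_orthonormal M I u \<and> L2_total M I u"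

definition expo :: "real \<Rightarrow> real \<Rightarrow> complex" where
  "expo l x = exp (2 * of_real pi * \<i> * of_real (l * x))"

definition is_spectrum :: "real measure \<Rightarrow> real set \<Rightarrow> bool" where
  "is_spectrum M \<Lambda> \<longleftrightarrow> L2_orthonormal_basis M \<Lambda> expo"

text \<open>Since \<open>div\<close> rounds towards minus infinity on \<open>int\<close>, this is
  \<open>k\<^sub>n = d\<^sub>n + 4 k\<^sub>n\<^sub>+\<^sub>1\<close> with \<open>d\<^sub>n \<in> {0,1,2,3}\<close>, also for negative \<open>k\<close>.\<close>

primrec base4_quot :: "int \<Rightarrow> nat \<Rightarrow> int" where
  "base4_quot k 0 = k"
| "base4_quot k (Suc n) = base4_quot k n div 4"

definition base4_digit :: "int \<Rightarrow> nat \<Rightarrow> int" where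
  "base4_digit k n = base4_quot k n mod 4"

definition ends_in :: "int \<Rightarrow> (nat \<Rightarrow> int) \<Rightarrow> bool" where
  "ends_in c d \<longleftrightarrow> (\<exists>N. \<forall>n\<ge>N. d n = c)"

text \<open>A vertex of the tree is the list of left/right choices leading to it from the root
  \<open>[]\<close>; its two children are \<open>v @ [False]\<close> and \<open>v @ [True]\<close>. An infinite downward path
  starting at a vertex is the sequence of its choices. A labeling \<open>L\<close> assigns the label
  \<open>L v b\<close> to the edge from \<open>v\<close> to \<open>v @ [b]\<close>.\<close>

type_synonym vertex = "bool list"
type_synonym inf_path = "nat \<Rightarrow> bool"
type_synonym labeling = "vertex \<Rightarrow> bool \<Rightarrow> int"

text \<open>The vertex reached after \<open>n\<close> steps, relative to the starting point of the path.\<close>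

definition path_vertex :: "inf_path \<Rightarrow> nat \<Rightarrow> vertex" where
  "path_vertex p n = map p [0..<n]"

definition path_labels :: "labeling \<Rightarrow> vertex \<Rightarrow> inf_path \<Rightarrow> nat \<Rightarrow> int" where
  "path_labels L v p n = L (v @ path_vertex p n) (p n)"

definition spectral_labeling :: "labeling \<Rightarrow> bool" where
  "spectral_labeling L \<longleftrightarrow>
     (\<forall>v b. L v b \<in> {0, 1, 2, 3}) \<and>
     (\<forall>v. even (L v False) \<noteq> even (L v True)) \<and>
     (\<forall>v. \<exists>p. ends_in 0 (path_labels L v p) \<or> ends_in 3 (path_labels L v p))"

definition sublabeling :: "labeling \<Rightarrow> vertex \<Rightarrow> labeling" where
  "sublabeling L v = (\<lambda>w b. L (v @ w) b)"

definition lies_on :: "vertex \<Rightarrow> inf_path \<Rightarrow> bool" where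
  "lies_on v p \<longleftrightarrow> (\<exists>n. v = path_vertex p n)"

definition Lambda :: "labeling \<Rightarrow> int set" where
  "Lambda L = {k. \<exists>p. path_labels L [] p = base4_digit k \<and>
     (ends_in 0 (path_labels L [] p) \<or> ends_in 3 (path_labels L [] p))}"

end

theory Submission
  imports Defs
begin

text \<open>Write \<open>F\<close> for the Fourier transform of \<open>\<mu>\<^sub>4\<close> and
  \<open>h\<^sub>\<L>(y) = \<Sum>\<^sub>l |F(y + l)|\<^sup>2\<close>, where \<open>l\<close>
  ranges over \<open>\<Lambda>(\<L>)\<close>. The exponentials with frequencies in
  \<open>\<Lambda>(\<L>)\<close> are always orthonormal, and by Bessel and Parseval they
  approximate \<open>e\<^sub>-\<^sub>y\<close> iff \<open>h\<^sub>\<L>(y) = 1\<close>. From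
  \<open>|F(t)|\<^sup>2 = w(t) |F(t/4)|\<^sup>2\<close> with \<open>w(t) =
  cos\<^sup>2(\<pi>t/2)\<close> one gets \<open>h\<^sub>\<L>(y) = \<Sum>\<^sub>d w(y + d)
  h\<^bsub>\<L>\<^sub>d\<^esub>((y + d)/4)\<close>, \<open>d\<close> running over the two labels
  at the root. The weights add up to \<open>1\<close> because the labels have different parity.
  Iterating to depth \<open>n\<close>, the vertices off the paths in \<open>S\<close> contribute
  with \<open>h = 1\<close>, so \<open>1 - h\<^sub>\<L>(y)\<close> is at most the sum, over the
  paths in \<open>S\<close>, of the products of the first \<open>n\<close> weights. Such a
  product tends to \<open>0\<close>: otherwise its factors tend to \<open>1\<close>, which
  pushes the points \<open>x\<^sub>n\<^sub>+\<^sub>1 = (x\<^sub>n + d\<^sub>n)/4\<close> towards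
  \<open>0\<close> or \<open>1\<close> and forces the labels to be eventually all
  \<open>0\<close> or all \<open>3\<close>. Finally, as \<open>S\<close> is finite, some vertex
  lies off \<open>S\<close>; its spectrum shows that exponentials span a dense subspace, so no
  density theorem is needed.\<close>

section \<open>Exponentials and the weight of the scaling equation\<close>

lemma expo_eq_cis: "expo l x = cis (2 * pi * (l * x))"
  by (simp add: expo_def cis_conv_exp mult_ac)

lemma norm_expo [simp]: "cmod (expo l x) = 1"
  by (simp add: expo_eq_cis)

lemma expo_add: "expo (a + b) x = expo a x * expo b x"
  by (simp add: expo_eq_cis cis_mult algebra_simps)

lemma cnj_expo: "cnj (expo a x) = expo (- a) x"
  by (simp add: expo_eq_cis cis_cnj)

lemma expo_0 [simp]: "expo 0 x = 1"
  by (simp add: expo_eq_cis)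

lemma continuous_on_expo: "continuous_on UNIV (expo l)"
  unfolding expo_def by (intro continuous_intros)

definition fourier :: "real measure \<Rightarrow> real \<Rightarrow> complex" where
  "fourier M t = (LINT x|M. expo t x)"

text \<open>The squared modulus of \<open>(1 + e\<^sup>i\<^sup>\<pi>\<^sup>t) / 2\<close>, the factor in the scaling equation of the Fourier transform.\<close>

definition weight :: "real \<Rightarrow> real" where
  "weight t = (cos (pi * t / 2))\<^sup>2"

lemma weight_nonneg: "0 \<le> weight t" and weight_le_1: "weight t \<le> 1"
  by (simp_all add: weight_def abs_square_le_1)

text \<open>A shift by \<open>2 * k\<close> moves the argument of the cosine by \<open>k\<close>
  times pi, which changes its sign at most.\<close>

lemma weight_add_even: "weight (t + 2 * of_int k) = weight t"
proof -
  have "cos (pi * t / 2 + pi * of_int k) = cos (pi * t / 2) * cos (pi * of_int k)"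
    by (simp add: cos_add sin_int_times_real mult.commute)
  moreover have "(cos (pi * of_int k))\<^sup>2 = 1"
    using sin_cos_squared_add[of "pi * of_int k"] by (simp add: mult.commute)
  ultimately have "(cos (pi * t / 2 + pi * of_int k))\<^sup>2 = (cos (pi * t / 2))\<^sup>2"
    by (simp add: power_mult_distrib)
  thus ?thesis by (simp add: weight_def algebra_simps add_divide_distrib)
qed

lemma weight_add_1: "weight (t + 1) = 1 - weight t"
proof -
  have "pi * (t + 1) / 2 = pi * t / 2 + pi / 2" by (simp add: algebra_simps add_divide_distrib)
  hence "cos (pi * (t + 1) / 2) = - sin (pi * t / 2)" by (simp only: cos_add) simp
  thus ?thesis by (simp add: weight_def cos_squared_eq)
qed

text \<open>Modulo 2 the two labels are 0 and 1 in some order, so the terms are a squared cosine and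
  the matching squared sine.\<close>

lemma weight_parity_sum:
  assumes "even a \<noteq> even (b :: int)"
  shows "weight (t + of_int a) + weight (t + of_int b) = 1"
proof -
  have "odd (b - a)" using assms by auto
  then obtain k where "b - a = 2 * k + 1" by (rule oddE)
  hence b: "real_of_int b = of_int a + 1 + 2 * of_int k" by linarith
  have "weight (t + of_int b) = weight ((t + of_int a + 1) + 2 * of_int k)"
    unfolding b by (simp add: algebra_simps)
  thus ?thesis by (simp add: weight_add_even weight_add_1 del: add.assoc)
qed

section \<open>Invariance of the measure for bounded continuous functions\<close>

text \<open>Continuous, 1 on \<open>[-n, n]\<close> and 0 outside \<open>[-n - 1, n + 1]\<close>:
  multiplication by it turns a bounded continuous function into a test function of
  \<open>is_mu4\<close>.\<close>

definition cutoff :: "nat \<Rightarrow> real \<Rightarrow> real" where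
  "cutoff n x = max 0 (min 1 (real n + 1 - \<bar>x\<bar>))"

lemma cutoff_tendsto: "(\<lambda>n. cutoff n x) \<longlonglongrightarrow> 1"
proof (rule tendsto_eventually)
  obtain N where "\<bar>x\<bar> \<le> real N" using real_arch_simple by blast
  thus "\<forall>\<^sub>F n in sequentially. cutoff n x = 1"
    unfolding eventually_sequentially cutoff_def by (intro exI[of _ N]) auto
qed

lemma continuous_on_cutoff: "continuous_on A (cutoff n)"
  unfolding cutoff_def[abs_def] by (intro continuous_intros)

lemma compact_support_cutoff:
  "compact (closure {x. of_real (cutoff n x) * f x \<noteq> (0::complex)})"
proof -
  have "{x. of_real (cutoff n x) * f x \<noteq> (0::complex)} \<subseteq> {- (real n + 1)..real n + 1}"
    by (auto simp: cutoff_def max_def min_def split: if_splits)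
  thus ?thesis
    by (meson bounded_closed_interval bounded_subset compact_closure)
qed

context
  fixes M :: "real measure"
  assumes mu4: "is_mu4 M"
begin

lemma prob_space_mu4: "prob_space M"
  using mu4 by (simp add: is_mu4_def)

interpretation prob_space M
  by (rule prob_space_mu4)

lemma sets_mu4: "sets M = sets borel"
  using mu4 by (simp add: is_mu4_def)

lemma borel_measurable_mu4:
  fixes f :: "real \<Rightarrow> 'b :: topological_space"
  assumes "continuous_on UNIV f"
  shows "f \<in> borel_measurable M"
  using borel_measurable_continuous_onI[OF assms] measurable_cong_sets[OF sets_mu4 refl] by blast

lemma integrable_mu4:
  fixes f :: "real \<Rightarrow> complex"
  assumes "continuous_on UNIV f" "\<And>x. cmod (f x) \<le> B"
  shows "integrable M f"
  by (rule integrable_const_bound[where B = B]) (use assms borel_measurable_mu4 in auto)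

text \<open>Dominated convergence with the constant bound \<open>B\<close>. The inner map
  \<open>T\<close> serves the three arguments \<open>x\<close>, \<open>x / 4\<close> and
  \<open>(x + 2) / 4\<close> of the invariance equation.\<close>

lemma cutoff_integral_tendsto:
  fixes f :: "real \<Rightarrow> complex"
  assumes f: "continuous_on UNIV f" "\<And>x. cmod (f x) \<le> B" and T: "continuous_on UNIV T"
  shows "(\<lambda>n. LINT x|M. of_real (cutoff n (T x)) * f (T x)) \<longlonglongrightarrow> (LINT x|M. f (T x))"
proof (rule integral_dominated_convergence[where w = "\<lambda>_. B"])
  have fT: "continuous_on UNIV (\<lambda>x. f (T x))"
    by (rule continuous_on_compose2[OF f(1) T]) simp
  show "(\<lambda>x. f (T x)) \<in> borel_measurable M"
    by (rule borel_measurable_mu4[OF fT])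
  show "(\<lambda>x. of_real (cutoff n (T x)) * f (T x)) \<in> borel_measurable M" for n
    by (intro borel_measurable_mu4 continuous_intros fT
        continuous_on_compose2[OF continuous_on_cutoff[of UNIV] T]) simp
  show "AE x in M. (\<lambda>n. of_real (cutoff n (T x)) * f (T x)) \<longlonglongrightarrow> f (T x)"
  proof (rule AE_I2)
    fix x
    have "(\<lambda>n. of_real (cutoff n (T x)) * f (T x)) \<longlonglongrightarrow> of_real 1 * f (T x)"
      by (intro tendsto_intros cutoff_tendsto)
    thus "(\<lambda>n. of_real (cutoff n (T x)) * f (T x)) \<longlonglongrightarrow> f (T x)" by simp
  qed
  show "AE x in M. cmod (of_real (cutoff n (T x)) * f (T x)) \<le> B" for n
  proof (rule AE_I2)
    fix x
    have "\<bar>cutoff n (T x)\<bar> * cmod (f (T x)) \<le> 1 * B"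
      by (intro mult_mono f) (auto simp: cutoff_def)
    thus "cmod (of_real (cutoff n (T x)) * f (T x)) \<le> B" by (simp add: norm_mult)
  qed
qed auto

lemma mu4_invariance:
  fixes f :: "real \<Rightarrow> complex"
  assumes f: "continuous_on UNIV f" "\<And>x. cmod (f x) \<le> B"
  shows "(LINT x|M. f x) = ((LINT x|M. f (x / 4)) + (LINT x|M. f ((x + 2) / 4))) / 2"
proof -
  let ?g = "\<lambda>n x. of_real (cutoff n x) * f x"
  have "(LINT x|M. ?g n x) = ((LINT x|M. ?g n (x / 4)) + (LINT x|M. ?g n ((x + 2) / 4))) / 2" for n
  proof -
    have "continuous_on UNIV (?g n)"
      by (intro continuous_intros continuous_on_cutoff f)
    thus ?thesis using mu4 compact_support_cutoff[of n f] unfolding is_mu4_def by blast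
  qed
  moreover have "(\<lambda>n. LINT x|M. ?g n x) \<longlonglongrightarrow> (LINT x|M. f x)"
    by (rule cutoff_integral_tendsto[OF f]) (intro continuous_intros)
  moreover have "(\<lambda>n. ((LINT x|M. ?g n (x / 4)) + (LINT x|M. ?g n ((x + 2) / 4))) / 2) \<longlonglongrightarrow>
     ((LINT x|M. f (x / 4)) + (LINT x|M. f ((x + 2) / 4))) / 2"
    by (intro tendsto_intros cutoff_integral_tendsto[OF f] continuous_intros) auto
  ultimately show ?thesis by (simp only: LIMSEQ_unique)
qed

section \<open>The Fourier transform of the measure\<close>

lemma integrable_expo: "integrable M (expo t)"
  by (rule integrable_mu4[where B = 1]) (simp_all add: continuous_on_expo)

lemma fourier_0: "fourier M 0 = 1"
  by (simp add: fourier_def prob_space)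

lemma fourier_minus: "fourier M (- t) = cnj (fourier M t)"
  unfolding fourier_def by (simp only: cnj_expo flip: Bochner_Integration.integral_cnj)

text \<open>Invariance applied to \<open>expo t\<close>: the shift by 2, after division by 4,
  contributes the phase \<open>cis (pi * t)\<close>.\<close>

lemma fourier_scale: "fourier M t = (1 + cis (pi * t)) / 2 * fourier M (t / 4)"
proof -
  have 1: "expo t (x / 4) = expo (t / 4) x" for x
    by (simp add: expo_def)
  have 2: "expo (t / 4) (x + 2) = cis (pi * t) * expo (t / 4) x" for x
    by (simp add: expo_eq_cis cis_mult algebra_simps add_divide_distrib)
  have "fourier M t = (fourier M (t / 4) + cis (pi * t) * fourier M (t / 4)) / 2"
    unfolding fourier_def
    by (subst mu4_invariance[OF continuous_on_expo, of t 1]) (simp_all only: 1 2 norm_expo order_refl integral_mult_right_zero)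
  thus ?thesis by (simp add: algebra_simps)
qed

lemma norm_fourier_scale: "(cmod (fourier M t))\<^sup>2 = weight t * (cmod (fourier M (t / 4)))\<^sup>2"
proof -
  have "(cmod (1 + cis (pi * t)))\<^sup>2 = (1 + cos (pi * t))\<^sup>2 + (sin (pi * t))\<^sup>2"
    by (simp add: cmod_power2)
  also have "\<dots> = 2 + 2 * cos (pi * t)"
    using sin_cos_squared_add[of "pi * t"] by (simp add: power2_eq_square algebra_simps)
  also have "\<dots> = 4 * weight t"
    using cos_double_cos[of "pi * t / 2"] by (simp add: weight_def)
  finally have "(cmod ((1 + cis (pi * t)) / 2))\<^sup>2 = weight t"
    by (simp add: norm_divide power_divide)
  thus ?thesis by (subst fourier_scale) (simp only: norm_mult power_mult_distrib)
qed

text \<open>At odd \<open>k\<close> the factor \<open>1 + cis (pi * k)\<close> of the scaling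
  equation vanishes.\<close>

lemma fourier_odd:
  assumes "odd k"
  shows "fourier M (of_int k) = 0"
proof -
  obtain j where k: "k = 2 * j + 1" using assms by (rule oddE)
  have "cis (pi * of_int k) = cis (pi + 2 * pi * of_int j)"
    by (simp add: k algebra_simps)
  also have "\<dots> = -1"
    by (simp add: cis_multiple_2pi flip: cis_mult)
  finally show ?thesis by (subst fourier_scale) simp
qed

text \<open>At \<open>4 * k\<close> the scaling factor is 1. Orthogonality of two frequencies can
  thus be tested after removal of a common first digit.\<close>

lemma fourier_4: "fourier M (4 * of_int k) = fourier M (of_int k)"
proof -
  have "cis (pi * (4 * of_int k)) = cis (2 * pi * of_int (2 * k))"
    by (simp add: algebra_simps)
  also have "\<dots> = 1" by (rule cis_multiple_2pi) simp
  finally show ?thesis by (subst fourier_scale) simp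
qed

lemma L2_inner_expo: "L2_inner M (expo a) (expo b) = fourier M (a - b)"
  by (simp add: L2_inner_def fourier_def cnj_expo flip: expo_add)

lemma L2_function_expo: "L2_function M (expo a)"
  by (simp add: L2_function_def borel_measurable_mu4 continuous_on_expo)

lemma L2_orthonormal_expo_iff:
  "L2_orthonormal M \<Lambda> expo \<longleftrightarrow> (\<forall>a\<in>\<Lambda>. \<forall>b\<in>\<Lambda>. a \<noteq> b \<longrightarrow> fourier M (a - b) = 0)"
  by (auto simp: L2_orthonormal_def L2_function_expo L2_inner_expo fourier_0)

text \<open>Expanding the square expresses the error through values
  \<open>fourier M (a - b)\<close>. It is least at \<open>c l = fourier M (y - l)\<close>, which
  yields Bessel's inequality.\<close>

lemma expo_approx_error:
  assumes orth: "L2_orthonormal M \<Lambda> expo" and F: "finite F" "F \<subseteq> \<Lambda>"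
  shows "(LINT x|M. (cmod (expo y x - (\<Sum>l\<in>F. c l * expo l x)))\<^sup>2) =
     1 - (\<Sum>l\<in>F. (cmod (fourier M (y - l)))\<^sup>2) + (\<Sum>l\<in>F. (cmod (fourier M (y - l) - c l))\<^sup>2)"
proof -
  let ?a = "\<lambda>l. fourier M (y - l)"
  have zero: "fourier M (l - m) = (if l = m then 1 else 0)" if "l \<in> F" "m \<in> F" for l m
    using orth that F fourier_0 unfolding L2_orthonormal_expo_iff by auto
  have cnj_a: "fourier M (l - y) = cnj (?a l)" for l
    by (simp flip: fourier_minus)
  have exp: "of_real ((cmod (expo y x - (\<Sum>l\<in>F. c l * expo l x)))\<^sup>2) =
      expo 0 x - (\<Sum>l\<in>F. c l * expo (l - y) x) - (\<Sum>l\<in>F. cnj (c l) * expo (y - l) x)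
      + (\<Sum>l\<in>F. \<Sum>m\<in>F. c l * cnj (c m) * expo (l - m) x)" for x
  proof -
    have e: "expo (a - b) x = expo a x * cnj (expo b x)" for a b
      by (simp add: cnj_expo flip: expo_add)
    have 1: "expo y x * cnj (expo y x) = 1"
      by (simp flip: e)
    show ?thesis
      unfolding complex_norm_square e
      by (simp add: 1 algebra_simps sum_distrib_left sum_distrib_right;
          rule sum.swap)
  qed
  have "of_real (LINT x|M. (cmod (expo y x - (\<Sum>l\<in>F. c l * expo l x)))\<^sup>2) =
     (LINT x|M. complex_of_real ((cmod (expo y x - (\<Sum>l\<in>F. c l * expo l x)))\<^sup>2))"
    by (rule integral_complex_of_real[symmetric])
  also have "\<dots> = 1 - (\<Sum>l\<in>F. c l * fourier M (l - y)) - (\<Sum>l\<in>F. cnj (c l) * ?a l)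
      + (\<Sum>l\<in>F. \<Sum>m\<in>F. c l * cnj (c m) * fourier M (l - m))"
    unfolding exp by (simp add: integrable_expo fourier_def prob_space)
  also have "(\<Sum>l\<in>F. \<Sum>m\<in>F. c l * cnj (c m) * fourier M (l - m)) = (\<Sum>l\<in>F. c l * cnj (c l))"
    by (intro sum.cong refl) (simp add: zero F if_distrib cong: if_cong)
  \<comment> \<open>Complete the square in each \<open>c l\<close>.\<close>
  also have "1 - (\<Sum>l\<in>F. c l * fourier M (l - y)) - (\<Sum>l\<in>F. cnj (c l) * ?a l)
      + (\<Sum>l\<in>F. c l * cnj (c l)) =
      1 - (\<Sum>l\<in>F. ?a l * cnj (?a l)) + (\<Sum>l\<in>F. (?a l - c l) * cnj (?a l - c l))"
    by (simp add: cnj_a algebra_simps sum.distrib sum_subtractf)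
  also have "\<dots> = of_real (1 - (\<Sum>l\<in>F. (cmod (?a l))\<^sup>2) + (\<Sum>l\<in>F. (cmod (?a l - c l))\<^sup>2))"
    by (simp only: complex_norm_square of_real_add of_real_diff of_real_sum of_real_1)
  finally show ?thesis by (simp only: of_real_eq_iff)
qed

end

section \<open>Weight products along a path\<close>

text \<open>\<open>weight (4 * t)\<close> is the squared cosine of \<open>2 * pi * t\<close>, which
  reaches 1 exactly at the half-integers.\<close>

lemma weight_near_1:
  "\<exists>c<1. \<forall>t. weight (4 * t) > c \<longrightarrow> (\<exists>m::int. \<bar>t - of_int m / 2\<bar> < 1 / 16)"
\<comment> \<open>The angle \<open>pi / 8\<close> matches the distance 1/16: with
  \<open>r = 2 * t - m\<close> the weight is the squared cosine of \<open>pi * r\<close>, and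
  \<open>r = 1 / 8\<close> means that \<open>t\<close> is 1/16 away from
  \<open>m / 2\<close>.\<close>
proof (intro exI[of _ "(cos (pi / 8))\<^sup>2"] conjI allI impI)
  have "cos (pi / 8) < cos 0" by (rule cos_monotone_0_pi) (use pi_gt_zero in auto)
  moreover have "0 < cos (pi / 8)" by (rule cos_gt_zero_pi) (use pi_gt_zero in auto)
  ultimately show "(cos (pi / 8))\<^sup>2 < 1" by (simp add: abs_square_less_1)
  fix t :: real
  assume w: "weight (4 * t) > (cos (pi / 8))\<^sup>2"
  define m where "m = round (2 * t)"
  define r where "r = 2 * t - of_int m"
  have r: "\<bar>r\<bar> \<le> 1 / 2"
    using of_int_round_abs_le[of "2 * t"] unfolding r_def m_def by linarith
  have "4 * t = 2 * r + 2 * of_int m" by (simp add: r_def)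
  hence "weight (4 * t) = (cos (pi * r))\<^sup>2"
    by (simp only: weight_add_even) (simp add: weight_def)
  hence w': "weight (4 * t) = (cos (pi * \<bar>r\<bar>))\<^sup>2"
    by (simp add: abs_if)
  have "\<bar>r\<bar> < 1 / 8"
  proof (rule ccontr)
    assume "\<not> \<bar>r\<bar> < 1 / 8"
    hence "cos (pi * \<bar>r\<bar>) \<le> cos (pi * (1 / 8))"
      using r pi_gt_zero by (intro cos_monotone_0_pi_le) auto
    moreover have "0 \<le> cos (pi * \<bar>r\<bar>)"
      by (rule cos_ge_zero) (use r pi_gt_zero in \<open>auto simp: field_simps intro: order_trans[of _ 0]\<close>)
    ultimately have "(cos (pi * \<bar>r\<bar>))\<^sup>2 \<le> (cos (pi / 8))\<^sup>2"
      by (intro power_mono) simp_all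
    thus False using w w' by simp
  qed
  thus "\<exists>m::int. \<bar>t - of_int m / 2\<bar> < 1 / 16"
    unfolding r_def by (intro exI[of _ m]) linarith
qed

text \<open>From \<open>x\<close> near 1/2 the next point lies within 1/64 of 1/8, 3/8, 5/8 or 7/8,
  each at distance 1/8 or more from 0, 1/2 and 1.\<close>

lemma quarter_step_not_half:
  fixes x y e :: real
  assumes y: "y = (x + e) / 4" and e: "e = 0 \<or> e = 1 \<or> e = 2 \<or> e = 3"
    and band: "\<bar>y\<bar> < 1 / 16 \<or> \<bar>y - 1 / 2\<bar> < 1 / 16 \<or> \<bar>y - 1\<bar> < 1 / 16"
  shows "\<not> \<bar>x - 1 / 2\<bar> < 1 / 16"
  using assms by argo

text \<open>The next point lies within 1/64 of \<open>e / 4\<close>, and among 0, 1/4, 1/2, 3/4 only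
  0 is close to 0 or 1.\<close>

lemma quarter_step_near_0:
  fixes x y e :: real
  assumes y: "y = (x + e) / 4" and e: "e = 0 \<or> e = 1 \<or> e = 2 \<or> e = 3"
    and band: "\<bar>y\<bar> < 1 / 16 \<or> \<bar>y - 1\<bar> < 1 / 16"
    and x: "\<bar>x\<bar> < 1 / 16"
  shows "e = 0"
  using assms by argo

text \<open>Mirror image of the previous case under \<open>x\<close> to \<open>1 - x\<close> and
  \<open>e\<close> to \<open>3 - e\<close>.\<close>

lemma quarter_step_near_1:
  fixes x y e :: real
  assumes y: "y = (x + e) / 4" and e: "e = 0 \<or> e = 1 \<or> e = 2 \<or> e = 3"
    and band: "\<bar>y\<bar> < 1 / 16 \<or> \<bar>y - 1\<bar> < 1 / 16"
    and x: "\<bar>x - 1\<bar> < 1 / 16"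
  shows "e = 3"
  using assms by argo

text \<open>Stated for plain sequences, \<open>X\<close> being the points and \<open>W\<close> the
  partial products. Points that stay near half-integers must stay near 0 or near 1, the fixed points
  of \<open>x / 4\<close> and \<open>(x + 3) / 4\<close>.\<close>

lemma weight_product_tendsto_0:
  fixes X W :: "nat \<Rightarrow> real" and d :: "nat \<Rightarrow> int"
  assumes d: "\<And>n. d n \<in> {0, 1, 2, 3}"
    and X: "\<And>n. X (Suc n) = (X n + of_int (d n)) / 4"
    and W0: "W 0 = 1" and W: "\<And>n. W (Suc n) = W n * weight (X n + of_int (d n))"
    and not_const: "\<not> ends_in 0 d" "\<not> ends_in 3 d"
  shows "W \<longlonglongrightarrow> 0"
proof (rule ccontr)
  assume not_0: "\<not> W \<longlonglongrightarrow> 0"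
  have W_nonneg: "0 \<le> W n" for n
    by (induction n) (simp_all add: W0 W weight_nonneg)
  have dec: "decseq W"
    by (rule decseq_SucI) (simp add: W mult_left_le W_nonneg weight_le_1)
  obtain l where l: "W \<longlonglongrightarrow> l" and l_le: "\<And>n. l \<le> W n"
    using decseq_convergent[OF dec, of 0] W_nonneg by metis
  have "0 \<le> l" using LIMSEQ_le_const[OF l] W_nonneg by blast
  with not_0 l have "0 < l" by (cases "l = 0") auto
  with l_le have W_pos: "0 < W n" for n by (meson less_le_trans)
  have "(\<lambda>n. W (Suc n) / W n) \<longlonglongrightarrow> l / l"
    using \<open>0 < l\<close> by (intro tendsto_divide l LIMSEQ_Suc[OF l]) auto
  \<comment> \<open>The weight is taken at \<open>X n + d n\<close>, which is
    \<open>4 * X (Suc n)\<close>.\<close>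
  moreover have "W (Suc n) / W n = weight (4 * X (Suc n))" for n
    using W_pos[of n] by (simp add: W X del: distrib_left_numeral)
  ultimately have lim: "(\<lambda>n. weight (4 * X (Suc n))) \<longlonglongrightarrow> 1"
    using \<open>0 < l\<close> by simp
  obtain c where "c < 1" and c: "\<And>t. weight (4 * t) > c \<Longrightarrow> \<exists>m::int. \<bar>t - of_int m / 2\<bar> < 1 / 16"
    using weight_near_1 by blast
  have "\<forall>\<^sub>F n in sequentially. c < weight (4 * X (Suc n))"
    using order_tendstoD(1)[OF lim \<open>c < 1\<close>] .
  hence "\<forall>\<^sub>F n in sequentially. c < weight (4 * X n)"
    using eventually_sequentially_Suc[of "\<lambda>n. c < weight (4 * X n)"] by blast
  moreover have "(\<lambda>n. \<bar>X 0\<bar> * (1 / 4) ^ n) \<longlonglongrightarrow> \<bar>X 0\<bar> * 0"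
    by (intro tendsto_intros) auto
  hence "\<forall>\<^sub>F n in sequentially. \<bar>X 0\<bar> * (1 / 4) ^ n < 1 / 16"
    by (intro order_tendstoD) auto
  ultimately have "\<forall>\<^sub>F n in sequentially. c < weight (4 * X n) \<and> \<bar>X 0\<bar> * (1 / 4) ^ n < 1 / 16"
    by (rule eventually_conj)
  then obtain N where N: "\<And>n. n \<ge> N \<Longrightarrow> c < weight (4 * X n) \<and> \<bar>X 0\<bar> * (1 / 4) ^ n < 1 / 16"
    unfolding eventually_sequentially by blast
  \<comment> \<open>The maps \<open>(x + d) / 4\<close> send [0, 1] into itself and contract by 4,
    so the excess over this interval dies out.\<close>
  have bound: "- (\<bar>X 0\<bar> * (1 / 4) ^ n) \<le> X n \<and> X n \<le> 1 + \<bar>X 0\<bar> * (1 / 4) ^ n" for n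
  proof (induction n)
    case (Suc n)
    have "0 \<le> real_of_int (d n) \<and> real_of_int (d n) \<le> (3 :: real)" using d[of n] by auto
    with Suc show ?case unfolding X by simp
  qed auto
  have band: "\<bar>X n\<bar> < 1 / 16 \<or> \<bar>X n - 1 / 2\<bar> < 1 / 16 \<or> \<bar>X n - 1\<bar> < 1 / 16" if n: "n \<ge> N" for n
  proof -
    obtain m :: int where m: "\<bar>X n - of_int m / 2\<bar> < 1 / 16"
      using c N[OF n] by blast
    have "-1 < real_of_int m" "real_of_int m < 3"
      using m bound[of n] N[OF n] by linarith+
    hence "m = 0 \<or> m = 1 \<or> m = 2" by linarith
    with m show ?thesis by auto
  qed
  have d_cases: "real_of_int (d n) = 0 \<or> real_of_int (d n) = 1 \<or> real_of_int (d n) = 2 \<or> real_of_int (d n) = 3" for n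
    using d[of n] by auto
  \<comment> \<open>One step ahead: the bands at \<open>Suc n\<close> exclude 1/2 at
    \<open>n\<close>.\<close>
  have not_half: "\<not> \<bar>X n - 1 / 2\<bar> < 1 / 16" if "n \<ge> N" for n
    by (rule quarter_step_not_half[OF X d_cases band[OF le_SucI[OF that]]])
  have band': "\<bar>X n\<bar> < 1 / 16 \<or> \<bar>X n - 1\<bar> < 1 / 16" if "n \<ge> N" for n
    using band[OF that] not_half[OF that] by blast
  have near_0: "d n = 0 \<and> \<bar>X (Suc n)\<bar> < 1 / 16" if "n \<ge> N" "\<bar>X n\<bar> < 1 / 16" for n
  proof -
    have "real_of_int (d n) = 0"
      by (rule quarter_step_near_0[OF X d_cases band'[OF le_SucI[OF that(1)]] that(2)])
    with that(2) show ?thesis unfolding X by simp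
  qed
  have near_1: "d n = 3 \<and> \<bar>X (Suc n) - 1\<bar> < 1 / 16" if "n \<ge> N" "\<bar>X n - 1\<bar> < 1 / 16" for n
  proof -
    have "real_of_int (d n) = 3"
      by (rule quarter_step_near_1[OF X d_cases band'[OF le_SucI[OF that(1)]] that(2)])
    moreover from this have "\<bar>X (Suc n) - 1\<bar> < 1 / 16" using X[of n] that(2) by argo
    ultimately show ?thesis by simp
  qed
  \<comment> \<open>Whichever endpoint is near at \<open>N\<close> stays near from then on and fixes
    the digit.\<close>
  consider "\<bar>X N\<bar> < 1 / 16" | "\<bar>X N - 1\<bar> < 1 / 16"
    using band'[OF order_refl] by blast
  thus False
  proof cases
    case 1
    have "\<bar>X n\<bar> < 1 / 16" if "n \<ge> N" for n
      using that by (induction n rule: dec_induct) (use 1 near_0 in auto)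
    hence "ends_in 0 d" using near_0 unfolding ends_in_def by blast
    with not_const show False by blast
  next
    case 2
    have "\<bar>X n - 1\<bar> < 1 / 16" if "n \<ge> N" for n
      using that by (induction n rule: dec_induct) (use 2 near_1 in auto)
    hence "ends_in 3 d" using near_1 unfolding ends_in_def by blast
    with not_const show False by blast
  qed
qed

section \<open>Closed linear spans in L2\<close>

lemma L2_norm_nonneg: "0 \<le> L2_norm M f"
  by (simp add: L2_norm_def)

lemma L2_norm_sq: "(L2_norm M f)\<^sup>2 = (LINT x|M. (cmod (f x))\<^sup>2)"
  by (simp add: L2_norm_def)

text \<open>Takes the place of Minkowski's inequality: two norms below \<open>\<epsilon> / 2\<close>
  give a sum below \<open>\<epsilon>\<close>, since \<open>2 * (\<epsilon> / 2)^2\<close> taken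
  twice is \<open>\<epsilon>^2\<close>.\<close>

lemma norm_add_sq_le: "(cmod (a + b))\<^sup>2 \<le> 2 * (cmod a)\<^sup>2 + 2 * (cmod b)\<^sup>2"
proof -
  have "(cmod (a + b))\<^sup>2 \<le> (cmod a + cmod b)\<^sup>2"
    by (intro power_mono norm_triangle_ineq) simp
  also have "\<dots> \<le> 2 * (cmod a)\<^sup>2 + 2 * (cmod b)\<^sup>2"
    using sum_squares_bound[of "cmod a" "cmod b"] by (simp add: power2_sum)
  finally show ?thesis .
qed

lemma L2_function_add:
  assumes "L2_function M f" "L2_function M g"
  shows "L2_function M (\<lambda>x. f x + g x)"
proof -
  have [measurable]: "f \<in> borel_measurable M" "g \<in> borel_measurable M"
    using assms by (simp_all add: L2_function_def)
  have "integrable M (\<lambda>x. 2 * (cmod (f x))\<^sup>2 + 2 * (cmod (g x))\<^sup>2)"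
    using assms by (simp add: L2_function_def)
  hence "integrable M (\<lambda>x. (cmod (f x + g x))\<^sup>2)"
    by (rule Bochner_Integration.integrable_bound) (auto simp: norm_add_sq_le)
  thus ?thesis by (simp add: L2_function_def)
qed

lemma L2_function_cmult: "L2_function M f \<Longrightarrow> L2_function M (\<lambda>x. a * f x)"
  unfolding L2_function_def by (auto intro: borel_measurable_times simp: norm_mult power_mult_distrib)

lemma L2_function_diff:
  "L2_function M f \<Longrightarrow> L2_function M g \<Longrightarrow> L2_function M (\<lambda>x. f x - g x)"
  using L2_function_add[OF _ L2_function_cmult, of M f g "-1"] by simp

lemma L2_function_lincomb:
  "(\<And>i. i \<in> F \<Longrightarrow> L2_function M (u i)) \<Longrightarrow> L2_function M (\<lambda>x. \<Sum>i\<in>F. c i * u i x)"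
proof (induction F rule: infinite_finite_induct)
  case (insert i F)
  have "L2_function M (\<lambda>x. c i * u i x + (\<Sum>i\<in>F. c i * u i x))"
    using insert by (intro L2_function_add[OF L2_function_cmult]) simp_all
  thus ?case using insert.hyps by simp
qed (simp_all add: L2_function_def)

lemma L2_norm_add_sq_le:
  assumes "L2_function M f" "L2_function M g"
  shows "(L2_norm M (\<lambda>x. f x + g x))\<^sup>2 \<le> 2 * (L2_norm M f)\<^sup>2 + 2 * (L2_norm M g)\<^sup>2"
proof -
  have "(LINT x|M. (cmod (f x + g x))\<^sup>2) \<le> (LINT x|M. 2 * (cmod (f x))\<^sup>2 + 2 * (cmod (g x))\<^sup>2)"
    using assms L2_function_add[OF assms]
    by (intro integral_mono norm_add_sq_le) (simp_all add: L2_function_def)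
  also have "\<dots> = 2 * (LINT x|M. (cmod (f x))\<^sup>2) + 2 * (LINT x|M. (cmod (g x))\<^sup>2)"
    using assms by (simp add: L2_function_def)
  finally show ?thesis by (simp add: L2_norm_sq)
qed

lemma L2_norm_add_less:
  assumes "L2_function M f" "L2_function M g" "L2_norm M f < \<epsilon> / 2" "L2_norm M g < \<epsilon> / 2"
  shows "L2_norm M (\<lambda>x. f x + g x) < \<epsilon>"
proof -
  have "(L2_norm M f)\<^sup>2 < (\<epsilon> / 2)\<^sup>2" "(L2_norm M g)\<^sup>2 < (\<epsilon> / 2)\<^sup>2"
    using assms L2_norm_nonneg by (auto intro!: power_strict_mono)
  hence "(L2_norm M (\<lambda>x. f x + g x))\<^sup>2 < \<epsilon>\<^sup>2"
    using L2_norm_add_sq_le[OF assms(1,2)] by (simp add: power_divide)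
  moreover have "0 \<le> \<epsilon>" using assms(3) L2_norm_nonneg[of M f] by simp
  ultimately show ?thesis by (rule power_less_imp_less_base)
qed

lemma L2_norm_cmult: "L2_norm M (\<lambda>x. a * f x) = cmod a * L2_norm M f"
  by (simp add: L2_norm_def norm_mult power_mult_distrib real_sqrt_mult)

text \<open>Membership in the closed linear span of the family \<open>u\<close>, for one function at
  a time.\<close>

definition L2_approximable ::
  "'a measure \<Rightarrow> 'i set \<Rightarrow> ('i \<Rightarrow> 'a \<Rightarrow> complex) \<Rightarrow> ('a \<Rightarrow> complex) \<Rightarrow> bool" where
  "L2_approximable M I u f \<longleftrightarrow>
     (\<forall>\<epsilon>>0. \<exists>F c. finite F \<and> F \<subseteq> I \<and> L2_norm M (\<lambda>x. f x - (\<Sum>i\<in>F. c i * u i x)) < \<epsilon>)"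

lemma L2_total_iff: "L2_total M I u \<longleftrightarrow> (\<forall>f. L2_function M f \<longrightarrow> L2_approximable M I u f)"
  by (simp add: L2_total_def L2_approximable_def)

lemma L2_approximableE:
  assumes "L2_approximable M I u f" "\<epsilon> > 0"
  obtains F c where "finite F" "F \<subseteq> I" "L2_norm M (\<lambda>x. f x - (\<Sum>i\<in>F. c i * u i x)) < \<epsilon>"
proof -
  have "\<exists>F c. finite F \<and> F \<subseteq> I \<and> L2_norm M (\<lambda>x. f x - (\<Sum>i\<in>F. c i * u i x)) < \<epsilon>"
    using assms by (simp add: L2_approximable_def)
  thus ?thesis by (elim exE conjE) (rule that)
qed

text \<open>Coefficients are extended by 0 to the union of the index sets and add up on the
  overlap.\<close>

lemma lincomb_union:
  fixes u :: "'i \<Rightarrow> 'a \<Rightarrow> complex"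
  assumes "finite F" "finite G"
  shows "(\<Sum>i\<in>F. c i * u i x) + (\<Sum>i\<in>G. d i * u i x) =
    (\<Sum>i\<in>F \<union> G. ((if i \<in> F then c i else 0) + (if i \<in> G then d i else 0)) * u i x)"
proof -
  have "(\<Sum>i\<in>F. c i * u i x) = (\<Sum>i\<in>F \<union> G. (if i \<in> F then c i else 0) * u i x)"
    using assms by (intro sum.mono_neutral_cong_left) auto
  moreover have "(\<Sum>i\<in>G. d i * u i x) = (\<Sum>i\<in>F \<union> G. (if i \<in> G then d i else 0) * u i x)"
    using assms by (intro sum.mono_neutral_cong_left) auto
  ultimately show ?thesis by (simp add: sum.distrib distrib_right)
qed

context
  fixes M :: "'a measure" and I :: "'i set" and u :: "'i \<Rightarrow> 'a \<Rightarrow> complex"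
  assumes u: "\<And>i. i \<in> I \<Longrightarrow> L2_function M (u i)"
begin

lemma L2_approximable_add:
  assumes "L2_function M f" "L2_function M g" "L2_approximable M I u f" "L2_approximable M I u g"
  shows "L2_approximable M I u (\<lambda>x. f x + g x)"
  unfolding L2_approximable_def
proof (intro allI impI)
  fix \<epsilon> :: real assume "\<epsilon> > 0"
  then obtain F c G d where F: "finite F" "F \<subseteq> I" "L2_norm M (\<lambda>x. f x - (\<Sum>i\<in>F. c i * u i x)) < \<epsilon> / 2"
    and G: "finite G" "G \<subseteq> I" "L2_norm M (\<lambda>x. g x - (\<Sum>i\<in>G. d i * u i x)) < \<epsilon> / 2"
    using assms(3,4) unfolding L2_approximable_def by (meson half_gt_zero)
  have "L2_norm M (\<lambda>x. (f x - (\<Sum>i\<in>F. c i * u i x)) + (g x - (\<Sum>i\<in>G. d i * u i x))) < \<epsilon>"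
    using assms F G u by (intro L2_norm_add_less L2_function_diff L2_function_lincomb) auto
  also have "(\<lambda>x. (f x - (\<Sum>i\<in>F. c i * u i x)) + (g x - (\<Sum>i\<in>G. d i * u i x))) =
     (\<lambda>x. f x + g x - (\<Sum>i\<in>F \<union> G. ((if i \<in> F then c i else 0) + (if i \<in> G then d i else 0)) * u i x))"
    unfolding lincomb_union[OF F(1) G(1), symmetric] by (simp add: algebra_simps)
  finally show "\<exists>F c. finite F \<and> F \<subseteq> I \<and> L2_norm M (\<lambda>x. f x + g x - (\<Sum>i\<in>F. c i * u i x)) < \<epsilon>"
    by (intro exI[of _ "F \<union> G"] exI conjI finite_UnI Un_least F G)
qed

lemma L2_approximable_cmult:
  assumes "L2_approximable M I u f"
  shows "L2_approximable M I u (\<lambda>x. a * f x)"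
  unfolding L2_approximable_def
proof (intro allI impI)
  fix \<epsilon> :: real assume "\<epsilon> > 0"
  \<comment> \<open>Adding 1 keeps the quotient positive also for \<open>a = 0\<close>.\<close>
  hence "\<epsilon> / (cmod a + 1) > 0" by (simp add: add_nonneg_pos)
  then obtain F c where F: "finite F" "F \<subseteq> I" "L2_norm M (\<lambda>x. f x - (\<Sum>i\<in>F. c i * u i x)) < \<epsilon> / (cmod a + 1)"
    using assms unfolding L2_approximable_def by blast
  let ?r = "L2_norm M (\<lambda>x. f x - (\<Sum>i\<in>F. c i * u i x))"
  have "L2_norm M (\<lambda>x. a * f x - (\<Sum>i\<in>F. (a * c i) * u i x)) = cmod a * ?r"
    by (simp add: right_diff_distrib sum_distrib_left mult.assoc flip: L2_norm_cmult)
  also have "\<dots> \<le> (cmod a + 1) * ?r"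
    by (intro mult_right_mono L2_norm_nonneg) simp
  also have "\<dots> < \<epsilon>"
    using F(3) by (simp add: pos_less_divide_eq add_nonneg_pos mult.commute)
  finally show "\<exists>F c. finite F \<and> F \<subseteq> I \<and> L2_norm M (\<lambda>x. a * f x - (\<Sum>i\<in>F. c i * u i x)) < \<epsilon>"
    by (intro exI[of _ F] exI[of _ "\<lambda>i. a * c i"] conjI F)
qed

lemma L2_approximable_lincomb:
  assumes "finite G" "\<And>j. j \<in> G \<Longrightarrow> L2_function M (v j)" "\<And>j. j \<in> G \<Longrightarrow> L2_approximable M I u (v j)"
  shows "L2_approximable M I u (\<lambda>x. \<Sum>j\<in>G. c j * v j x)"
  using assms
proof (induction G rule: finite_induct)
  case empty
  have "L2_norm M (\<lambda>x. 0 - (\<Sum>i\<in>{}. c i * u i x)) = 0" for c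
    by (simp add: L2_norm_def)
  thus ?case unfolding L2_approximable_def by (intro allI impI exI[of _ "{}"] exI conjI) simp_all
next
  case (insert j G)
  have "L2_approximable M I u (\<lambda>x. c j * v j x + (\<Sum>j\<in>G. c j * v j x))"
  proof (rule L2_approximable_add)
    show "L2_function M (\<lambda>x. c j * v j x)" "L2_approximable M I u (\<lambda>x. c j * v j x)"
      using insert.prems by (simp_all add: L2_function_cmult L2_approximable_cmult)
    show "L2_function M (\<lambda>x. \<Sum>j\<in>G. c j * v j x)"
      using insert.prems by (intro L2_function_lincomb) simp
    show "L2_approximable M I u (\<lambda>x. \<Sum>j\<in>G. c j * v j x)"
      using insert.prems by (intro insert.IH) simp_all
  qed
  thus ?case using insert.hyps by simp
qed

text \<open>A combination of the \<open>v j\<close> within \<open>\<epsilon> / 2\<close> of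
  \<open>f\<close> lies in the closed span of \<open>u\<close>, so a combination of the
  \<open>u i\<close> is within \<open>\<epsilon> / 2\<close> of it.\<close>

lemma L2_total_trans:
  assumes v: "\<And>j. j \<in> J \<Longrightarrow> L2_function M (v j)" "\<And>j. j \<in> J \<Longrightarrow> L2_approximable M I u (v j)"
    and total: "L2_total M J v"
  shows "L2_total M I u"
  unfolding L2_total_def
proof (intro allI impI)
  fix f :: "'a \<Rightarrow> complex" and \<epsilon> :: real assume f: "L2_function M f" and "\<epsilon> > 0"
  hence half: "\<epsilon> / 2 > 0" by simp
  have "L2_approximable M J v f" using total f by (simp add: L2_total_iff)
  from L2_approximableE[OF this half] obtain G d where G: "finite G" "G \<subseteq> J" "L2_norm M (\<lambda>x. f x - (\<Sum>j\<in>G. d j * v j x)) < \<epsilon> / 2"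
    by blast
  let ?g = "\<lambda>x. \<Sum>j\<in>G. d j * v j x"
  have g: "L2_function M ?g" "L2_approximable M I u ?g"
  proof -
    have G': "L2_function M (v j)" "L2_approximable M I u (v j)" if "j \<in> G" for j
      using that G(2) v by blast+
    show "L2_function M ?g" by (rule L2_function_lincomb) (rule G')
    show "L2_approximable M I u ?g" by (rule L2_approximable_lincomb) (simp_all add: G(1) G')
  qed
  from L2_approximableE[OF g(2) half] obtain F c where F: "finite F" "F \<subseteq> I" "L2_norm M (\<lambda>x. ?g x - (\<Sum>i\<in>F. c i * u i x)) < \<epsilon> / 2"
    by blast
  have "L2_norm M (\<lambda>x. (f x - ?g x) + (?g x - (\<Sum>i\<in>F. c i * u i x))) < \<epsilon>"
  proof (rule L2_norm_add_less)
    have "L2_function M (\<lambda>x. \<Sum>i\<in>F. c i * u i x)"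
      using u F(2) by (intro L2_function_lincomb) blast
    with g(1) show "L2_function M (\<lambda>x. ?g x - (\<Sum>i\<in>F. c i * u i x))"
      by (rule L2_function_diff)
    show "L2_function M (\<lambda>x. f x - ?g x)"
      using f g(1) by (rule L2_function_diff)
  qed (fact G(3) F(3))+
  thus "\<exists>F c. finite F \<and> F \<subseteq> I \<and> L2_norm M (\<lambda>x. f x - (\<Sum>i\<in>F. c i * u i x)) < \<epsilon>"
    by (intro exI[of _ F] exI[of _ c] conjI F) (simp only: add_diff_eq diff_add_cancel)
qed

end

section \<open>Splitting off the first digit\<close>

text \<open>The definition peels off the last division; removing the first digit requires peeling
  off the first one.\<close>

lemma base4_quot_Suc: "base4_quot k (Suc n) = base4_quot (k div 4) n"
  by (induction n) simp_all

lemma base4_digit_0: "base4_digit k 0 = k mod 4"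
  by (simp add: base4_digit_def)

lemma base4_digit_Suc: "base4_digit k (Suc n) = base4_digit (k div 4) n"
  by (simp only: base4_digit_def base4_quot_Suc)

lemma ends_in_Suc_iff: "ends_in c (\<lambda>n. d (Suc n)) \<longleftrightarrow> ends_in c d"
proof
  assume "ends_in c (\<lambda>n. d (Suc n))"
  then obtain N where "\<forall>n\<ge>N. d (Suc n) = c" by (auto simp: ends_in_def)
  hence "\<forall>n\<ge>Suc N. d n = c" by (metis Suc_le_D Suc_le_mono)
  thus "ends_in c d" unfolding ends_in_def by blast
next
  assume "ends_in c d"
  then obtain N where "\<forall>n\<ge>N. d n = c" by (auto simp: ends_in_def)
  hence "\<forall>n\<ge>N. d (Suc n) = c" by simp
  thus "ends_in c (\<lambda>n. d (Suc n))" unfolding ends_in_def by blast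
qed

lemma path_vertex_Suc: "path_vertex p (Suc n) = p 0 # path_vertex (\<lambda>n. p (Suc n)) n"
  by (simp add: path_vertex_def map_upt_Suc del: upt_Suc)

lemma path_vertex_snoc: "path_vertex p (Suc n) = path_vertex p n @ [p n]"
  by (simp add: path_vertex_def)

lemma sublabeling_Nil [simp]: "sublabeling L [] = L"
  by (simp add: sublabeling_def)

lemma sublabeling_sublabeling: "sublabeling (sublabeling L v) w = sublabeling L (v @ w)"
  by (simp add: sublabeling_def)

lemma path_labels_0: "path_labels L [] p 0 = L [] (p 0)"
  by (simp add: path_labels_def path_vertex_def)

lemma path_labels_Suc:
  "path_labels L [] p (Suc n) = path_labels (sublabeling L [p 0]) [] (\<lambda>n. p (Suc n)) n"
  by (simp add: path_labels_def path_vertex_Suc sublabeling_def)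

text \<open>The conditions on a single vertex and its two edges; they pass to every subtree, as the
  inductions below require.\<close>

definition parity_labeling :: "labeling \<Rightarrow> bool" where
  "parity_labeling L \<longleftrightarrow>
     (\<forall>v b. L v b \<in> {0, 1, 2, 3}) \<and> (\<forall>v. even (L v False) \<noteq> even (L v True))"

lemma parity_labeling_sublabeling: "parity_labeling L \<Longrightarrow> parity_labeling (sublabeling L v)"
  by (simp add: parity_labeling_def sublabeling_def)

lemma parity_labeling_inj: "parity_labeling L \<Longrightarrow> even (L v a) = even (L v b) \<Longrightarrow> a = b"
  by (cases a; cases b) (auto simp: parity_labeling_def)

text \<open>The first digit of \<open>k\<close> is its residue modulo 4 and the others are the
  digits of \<open>k div 4\<close>; dropping the first edge leaves a path in the subtree with the
  same tail.\<close>

lemma mem_Lambda_iff: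
  assumes "parity_labeling L"
  shows "k \<in> Lambda L \<longleftrightarrow> (\<exists>b j. k = L [] b + 4 * j \<and> j \<in> Lambda (sublabeling L [b]))"
proof
  assume "k \<in> Lambda L"
  then obtain p where p: "path_labels L [] p = base4_digit k"
    "ends_in 0 (path_labels L [] p) \<or> ends_in 3 (path_labels L [] p)"
    by (auto simp: Lambda_def)
  let ?q = "path_labels (sublabeling L [p 0]) [] (\<lambda>n. p (Suc n))"
  have "?q = base4_digit (k div 4)"
    by (rule ext) (simp only: p(1) flip: path_labels_Suc base4_digit_Suc)
  moreover have "ends_in c ?q \<longleftrightarrow> ends_in c (path_labels L [] p)" for c
    unfolding ends_in_Suc_iff[of c "path_labels L [] p", symmetric] path_labels_Suc ..
  ultimately have "k div 4 \<in> Lambda (sublabeling L [p 0])"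
    using p(2) by (auto simp: Lambda_def)
  moreover have "k mod 4 = L [] (p 0)"
    using fun_cong[OF p(1), of 0] by (simp add: path_labels_0 base4_digit_0)
  hence "k = L [] (p 0) + 4 * (k div 4)"
    using mod_mult_div_eq[of k 4] by simp
  ultimately show "\<exists>b j. k = L [] b + 4 * j \<and> j \<in> Lambda (sublabeling L [b])" by blast
next
  assume "\<exists>b j. k = L [] b + 4 * j \<and> j \<in> Lambda (sublabeling L [b])"
  then obtain b j q where k: "k = L [] b + 4 * j"
    and q: "path_labels (sublabeling L [b]) [] q = base4_digit j"
     "ends_in 0 (path_labels (sublabeling L [b]) [] q) \<or> ends_in 3 (path_labels (sublabeling L [b]) [] q)"
    by (auto simp: Lambda_def)
  \<comment> \<open>The path \<open>q\<close> of the subtree with the edge \<open>b\<close> put in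
    front.\<close>
  define p where "p = case_nat b q"
  have p: "p 0 = b" "(\<lambda>n. p (Suc n)) = q" by (simp_all add: p_def)
  have "L [] b \<in> {0, 1, 2, 3}" using assms by (simp add: parity_labeling_def)
  hence "k mod 4 = L [] b" "k div 4 = j" using k by auto
  hence "path_labels L [] p n = base4_digit k n" for n
    by (cases n) (simp_all add: path_labels_0 path_labels_Suc base4_digit_0 base4_digit_Suc p q)
  moreover have "ends_in c (path_labels L [] p) \<longleftrightarrow> ends_in c (path_labels (sublabeling L [b]) [] q)" for c
    unfolding ends_in_Suc_iff[of c "path_labels L [] p", symmetric] path_labels_Suc p ..
  ultimately show "k \<in> Lambda L" using q(2) unfolding Lambda_def by blast
qed

lemma Lambda_decompose:
  assumes "parity_labeling L"
  shows "Lambda L = (\<Union>b. (\<lambda>j. L [] b + 4 * j) ` Lambda (sublabeling L [b]))"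
  using mem_Lambda_iff[OF assms] by blast

section \<open>Points and weights at the vertices of the tree\<close>

text \<open>The argument at which the spectral sum of the subtree at \<open>v\<close> appears once
  its recursion has been followed along \<open>v\<close>; \<open>path_weight\<close> is the
  coefficient in front.\<close>

fun node_point :: "labeling \<Rightarrow> real \<Rightarrow> vertex \<Rightarrow> real" where
  "node_point L x [] = x"
| "node_point L x (b # v) = node_point (sublabeling L [b]) ((x + of_int (L [] b)) / 4) v"

fun path_weight :: "labeling \<Rightarrow> real \<Rightarrow> vertex \<Rightarrow> real" where
  "path_weight L x [] = 1"
| "path_weight L x (b # v) =
     weight (x + of_int (L [] b)) * path_weight (sublabeling L [b]) ((x + of_int (L [] b)) / 4) v"

lemma path_weight_nonneg: "0 \<le> path_weight L x v"
  by (induction v arbitrary: L x) (simp_all add: weight_nonneg)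

text \<open>Recursion at the lower end of the vertex, as needed to follow an infinite path
  downwards; the definition recurses at the root.\<close>

lemma node_point_snoc: "node_point L x (v @ [b]) = (node_point L x v + of_int (L v b)) / 4"
  by (induction v arbitrary: L x) (simp_all add: sublabeling_def)

lemma path_weight_snoc:
  "path_weight L x (v @ [b]) = path_weight L x v * weight (node_point L x v + of_int (L v b))"
  by (induction v arbitrary: L x) (simp_all add: sublabeling_def)

lemma path_weight_tendsto_0:
  assumes L: "parity_labeling L"
    and p: "\<not> ends_in 0 (path_labels L [] p)" "\<not> ends_in 3 (path_labels L [] p)"
  shows "(\<lambda>n. path_weight L x (path_vertex p n)) \<longlonglongrightarrow> 0"
proof (rule weight_product_tendsto_0[OF _ _ _ _ p, where X = "\<lambda>n. node_point L x (path_vertex p n)"])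
  show "path_labels L [] p n \<in> {0, 1, 2, 3}" for n
    using L by (simp add: parity_labeling_def path_labels_def)
  show "path_weight L x (path_vertex p 0) = 1"
    by (simp add: path_vertex_def)
qed (simp_all add: path_vertex_snoc node_point_snoc path_weight_snoc path_labels_def)

lemma sum_vertices_Suc:
  fixes f :: "vertex \<Rightarrow> 'a :: comm_monoid_add"
  shows "(\<Sum>v | length v = Suc n. f v) = (\<Sum>b\<in>UNIV. \<Sum>v | length v = n. f (b # v))"
proof -
  have "(\<Sum>b\<in>UNIV. \<Sum>v | length v = n. f (b # v)) = (\<Sum>(b, v)\<in>UNIV \<times> {v. length v = n}. f (b # v))"
    using finite_lists_length_eq[of "UNIV :: bool set" n] by (simp add: sum.cartesian_product)
  also have "\<dots> = (\<Sum>v | length v = Suc n. f v)"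
    by (rule sum.reindex_bij_witness[of _ "\<lambda>v. (hd v, tl v)" "\<lambda>(b, v). b # v"])
      (auto simp: length_Suc_conv)
  finally show ?thesis ..
qed

lemma weight_sum:
  assumes "parity_labeling L"
  shows "(\<Sum>b\<in>UNIV. weight (x + of_int (L v b))) = 1"
  using weight_parity_sum[of "L v False" "L v True" x] assms
  by (simp add: UNIV_bool parity_labeling_def add.commute)

text \<open>The two edge weights below each vertex add up to 1, so the total is conserved from level
  to level.\<close>

lemma path_weight_sum:
  "parity_labeling L \<Longrightarrow> (\<Sum>v | length v = n. path_weight L x v) = 1"
proof (induction n arbitrary: L x)
  case (Suc n)
  have "(\<Sum>v | length v = Suc n. path_weight L x v) =
    (\<Sum>b\<in>UNIV. weight (x + of_int (L [] b)) *
       (\<Sum>v | length v = n. path_weight (sublabeling L [b]) ((x + of_int (L [] b)) / 4) v))"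
    by (simp add: sum_vertices_Suc sum_distrib_left)
  also have "\<dots> = 1"
    using weight_sum[OF Suc.prems] by (simp add: Suc parity_labeling_sublabeling)
  finally show ?case .
qed simp

text \<open>Level \<open>card S\<close> has \<open>2 ^ card S\<close> vertices, more than
  \<open>card S\<close>, and each path meets the level only once.\<close>

lemma exists_vertex_off_paths:
  assumes "finite S"
  obtains v where "\<forall>p\<in>S. \<not> lies_on v p"
proof -
  let ?n = "card S"
  have "card ((\<lambda>p. path_vertex p ?n) ` S) \<le> ?n" by (rule card_image_le[OF assms])
  also have "\<dots> < card {v :: vertex. length v = ?n}"
    using card_lists_length_eq[of "UNIV :: bool set" ?n] by simp
  finally obtain v :: vertex where "length v = ?n" "v \<notin> (\<lambda>p. path_vertex p ?n) ` S"
    using card_mono[of "(\<lambda>p. path_vertex p ?n) ` S" "{v. length v = ?n}"] assms by force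
  hence "\<forall>p\<in>S. \<not> lies_on v p"
    by (auto simp: lies_on_def path_vertex_def)
  thus ?thesis by (rule that)
qed

section \<open>Spectral sums and approximation of exponentials\<close>

text \<open>The function \<open>h\<close>, for any set of frequencies. As \<open>infsum\<close> is 0
  on families that are not summable, comparisons with finite sums go through summability.\<close>

definition spectral_sum :: "real measure \<Rightarrow> real set \<Rightarrow> real \<Rightarrow> real" where
  "spectral_sum M \<Lambda> y = (\<Sum>\<^sub>\<infinity>l\<in>\<Lambda>. (cmod (fourier M (y + l)))\<^sup>2)"

lemma spectral_sum_nonneg: "0 \<le> spectral_sum M \<Lambda> y"
  unfolding spectral_sum_def by (rule infsum_nonneg) simp

context
  fixes M :: "real measure"
  assumes mu4: "is_mu4 M"
begin

lemma cmod_fourier_minus: "cmod (fourier M (- t)) = cmod (fourier M t)"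
  by (simp add: fourier_minus[OF mu4])

text \<open>Approximating the frequency \<open>- y\<close> brings in the moduli at
  \<open>y + l\<close>, the form to which the scaling recursion applies.\<close>

lemma L2_norm_expo_approx:
  assumes orth: "L2_orthonormal M \<Lambda> expo" and F: "finite F" "F \<subseteq> \<Lambda>"
  shows "(L2_norm M (\<lambda>x. expo (- y) x - (\<Sum>l\<in>F. c l * expo l x)))\<^sup>2 =
     1 - (\<Sum>l\<in>F. (cmod (fourier M (y + l)))\<^sup>2) + (\<Sum>l\<in>F. (cmod (fourier M (- y - l) - c l))\<^sup>2)"
proof -
  have "cmod (fourier M (- y - l)) = cmod (fourier M (y + l))" for l
    using cmod_fourier_minus[of "y + l"] by simp
  thus ?thesis by (simp add: L2_norm_sq expo_approx_error[OF mu4 orth F])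
qed

lemma bessel_expo:
  assumes "L2_orthonormal M \<Lambda> expo" "finite F" "F \<subseteq> \<Lambda>"
  shows "(\<Sum>l\<in>F. (cmod (fourier M (y + l)))\<^sup>2) \<le> 1"
  using L2_norm_expo_approx[OF assms, of y "\<lambda>l. fourier M (- y - l)"]
    zero_le_power2[of "L2_norm M (\<lambda>x. expo (- y) x - (\<Sum>l\<in>F. fourier M (- y - l) * expo l x))"]
  by simp

lemma summable_spectral_sum:
  assumes "L2_orthonormal M \<Lambda> expo"
  shows "(\<lambda>l. (cmod (fourier M (y + l)))\<^sup>2) summable_on \<Lambda>"
  by (rule nonneg_bdd_above_summable_on) (auto intro!: bdd_aboveI[of _ 1] bessel_expo[OF assms])

text \<open>Bessel gives the upper bound. Conversely, a deviation from the Fourier coefficients only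
  adds to the error, so a squared error below \<open>e\<close> forces a partial sum above
  \<open>1 - e\<close>.\<close>

lemma spectral_sum_eq_1_if_total:
  assumes orth: "L2_orthonormal M \<Lambda> expo" and total: "L2_total M \<Lambda> expo"
  shows "spectral_sum M \<Lambda> y = 1"
proof (rule antisym)
  show "spectral_sum M \<Lambda> y \<le> 1"
    unfolding spectral_sum_def
    by (rule infsum_le_finite_sums[OF summable_spectral_sum[OF orth] bessel_expo[OF orth]])
  show "1 \<le> spectral_sum M \<Lambda> y"
  proof (rule field_le_epsilon)
    fix e :: real assume "e > 0"
    hence "sqrt e > 0" by simp
    have "L2_approximable M \<Lambda> expo (expo (- y))"
      using total L2_function_expo[OF mu4] by (simp add: L2_total_iff)
    from L2_approximableE[OF this \<open>sqrt e > 0\<close>] obtain F c where F: "finite F" "F \<subseteq> \<Lambda>"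
      "L2_norm M (\<lambda>x. expo (- y) x - (\<Sum>l\<in>F. c l * expo l x)) < sqrt e"
      by blast
    have "(L2_norm M (\<lambda>x. expo (- y) x - (\<Sum>l\<in>F. c l * expo l x)))\<^sup>2 < (sqrt e)\<^sup>2"
      by (rule power_strict_mono[OF F(3) L2_norm_nonneg]) simp
    hence "1 - (\<Sum>l\<in>F. (cmod (fourier M (y + l)))\<^sup>2) < e"
      unfolding L2_norm_expo_approx[OF orth F(1,2)]
      using \<open>e > 0\<close> sum_nonneg[of F "\<lambda>l. (cmod (fourier M (- y - l) - c l))\<^sup>2"] by simp
    moreover have "(\<Sum>l\<in>F. (cmod (fourier M (y + l)))\<^sup>2) \<le> spectral_sum M \<Lambda> y"
      unfolding spectral_sum_def
      by (rule finite_sum_le_infsum[OF summable_spectral_sum[OF orth] F(1,2)]) simp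
    ultimately show "1 \<le> spectral_sum M \<Lambda> y + e" by simp
  qed
qed

text \<open>With Fourier coefficients the squared error is 1 minus a partial sum, and partial sums
  come close to a value of at least 1.\<close>

lemma L2_approximable_expo_if_spectral_sum:
  assumes orth: "L2_orthonormal M \<Lambda> expo" and ge_1: "1 \<le> spectral_sum M \<Lambda> y"
  shows "L2_approximable M \<Lambda> expo (expo (- y))"
  unfolding L2_approximable_def
proof (intro allI impI)
  fix \<epsilon> :: real assume "\<epsilon> > 0"
  hence "\<epsilon>\<^sup>2 / 2 > 0" by simp
  then obtain F where F: "finite F" "F \<subseteq> \<Lambda>"
    "dist (\<Sum>l\<in>F. (cmod (fourier M (y + l)))\<^sup>2) (spectral_sum M \<Lambda> y) \<le> \<epsilon>\<^sup>2 / 2"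
    unfolding spectral_sum_def
    using infsum_finite_approximation[OF summable_spectral_sum[OF orth]] by blast
  have "(L2_norm M (\<lambda>x. expo (- y) x - (\<Sum>l\<in>F. fourier M (- y - l) * expo l x)))\<^sup>2 \<le> \<epsilon>\<^sup>2 / 2"
    using F(3) ge_1 unfolding L2_norm_expo_approx[OF orth F(1,2)] dist_real_def abs_le_iff by simp
  also have "\<dots> < \<epsilon>\<^sup>2" using \<open>\<epsilon> > 0\<close> by simp
  finally have "L2_norm M (\<lambda>x. expo (- y) x - (\<Sum>l\<in>F. fourier M (- y - l) * expo l x)) < \<epsilon>"
    by (rule power_less_imp_less_base) (use \<open>\<epsilon> > 0\<close> in simp)
  thus "\<exists>F c. finite F \<and> F \<subseteq> \<Lambda> \<and> L2_norm M (\<lambda>x. expo (- y) x - (\<Sum>l\<in>F. c l * expo l x)) < \<epsilon>"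
    by (intro exI[of _ F] exI[of _ "\<lambda>l. fourier M (- y - l)"] conjI F)
qed

section \<open>Orthogonality and spectral sums of labelings\<close>

text \<open>Different first edges make \<open>j - k\<close> odd, a zero of the transform. A common
  first edge leaves a difference four times smaller with the same value of the transform, so
  induction reaches the first branching.\<close>

lemma fourier_Lambda_diff:
  "parity_labeling L \<Longrightarrow> j \<in> Lambda L \<Longrightarrow> k \<in> Lambda L \<Longrightarrow> j \<noteq> k \<Longrightarrow> fourier M (of_int (j - k)) = 0"
proof (induction "nat \<bar>j - k\<bar>" arbitrary: L j k rule: less_induct)
  case less
  obtain a j' where j: "j = L [] a + 4 * j'" "j' \<in> Lambda (sublabeling L [a])"
    using less.prems mem_Lambda_iff by blast
  obtain b k' where k: "k = L [] b + 4 * k'" "k' \<in> Lambda (sublabeling L [b])"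
    using less.prems mem_Lambda_iff by blast
  show ?case
  proof (cases "a = b")
    case True
    have diff: "j - k = 4 * (j' - k')" using j k True by simp
    with less.prems have "j' \<noteq> k'" by auto
    hence "fourier M (of_int (j' - k')) = 0"
      using j(2) k(2) diff True less.prems(1)
      by (intro less.hyps[of j' k' "sublabeling L [a]"]) (auto simp: parity_labeling_sublabeling)
    thus ?thesis using fourier_4[OF mu4, of "j' - k'"] by (simp add: diff)
  next
    case False
    hence "odd (L [] a - L [] b)" using parity_labeling_inj[OF less.prems(1), of "[]" a b] by auto
    hence "odd (j - k)" using j k by simp
    thus ?thesis by (rule fourier_odd[OF mu4])
  qed
qed

lemma L2_orthonormal_Lambda:
  "parity_labeling L \<Longrightarrow> L2_orthonormal M (real_of_int ` Lambda L) expo"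
  unfolding L2_orthonormal_expo_iff[OF mu4]
  using fourier_Lambda_diff by (auto simp flip: of_int_diff)

text \<open>\<open>Lambda L\<close> splits according to the first edge, and on each part
  \<open>norm_fourier_scale\<close> extracts the same weight from all terms.\<close>

lemma spectral_sum_Lambda_step:
  assumes L: "parity_labeling L"
  shows "spectral_sum M (real_of_int ` Lambda L) y =
    (\<Sum>b\<in>UNIV. weight (y + of_int (L [] b)) *
      spectral_sum M (real_of_int ` Lambda (sublabeling L [b])) ((y + of_int (L [] b)) / 4))"
proof -
  define f where "f l = (cmod (fourier M (y + l)))\<^sup>2" for l
  define A where "A b = (\<lambda>j. L [] b + 4 * j) ` Lambda (sublabeling L [b])" for b
  have Lambda: "Lambda L = A False \<union> A True"
    unfolding A_def Lambda_decompose[OF L] by (simp add: UNIV_bool)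
  \<comment> \<open>All elements of \<open>A b\<close> have the parity of the label of the edge
    \<open>b\<close> at the root.\<close>
  have "real_of_int ` A False \<inter> real_of_int ` A True = {}"
  proof -
    have "a \<noteq> b" if "a \<in> A False" "b \<in> A True" for a b
    proof -
      have "even a \<noteq> even b" using that L by (auto simp: A_def parity_labeling_def)
      thus ?thesis by blast
    qed
    thus ?thesis by auto
  qed
  moreover have "f summable_on real_of_int ` Lambda L"
    unfolding f_def by (rule summable_spectral_sum[OF L2_orthonormal_Lambda[OF L]])
  hence "f summable_on real_of_int ` A b" for b
    by (rule summable_on_subset_banach) (cases b; auto simp: Lambda)
  ultimately have "infsum f (real_of_int ` Lambda L) = (\<Sum>b\<in>UNIV. infsum f (real_of_int ` A b))"
    unfolding Lambda image_Un by (simp add: infsum_Un_disjoint UNIV_bool add.commute)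
  moreover have "infsum f (real_of_int ` A b) = weight (y + of_int (L [] b)) *
      spectral_sum M (real_of_int ` Lambda (sublabeling L [b])) ((y + of_int (L [] b)) / 4)" for b
  proof -
    define h where "h l = of_int (L [] b) + 4 * l" for l :: real
    have image: "real_of_int ` A b = h ` real_of_int ` Lambda (sublabeling L [b])"
      by (simp add: A_def h_def image_image)
    have step: "f (h l) = weight (y + of_int (L [] b)) * (cmod (fourier M ((y + of_int (L [] b)) / 4 + l)))\<^sup>2"
      if "l \<in> real_of_int ` Lambda (sublabeling L [b])" for l
    proof -
      obtain j :: int where l: "l = of_int j" using \<open>l \<in> _\<close> by blast
      \<comment> \<open>The frequency in the subtree enters as \<open>4 * j = 2 * (2 * j)\<close>, a
        period of the weight.\<close>
      have "weight (y + h l) = weight (y + of_int (L [] b) + 2 * of_int (2 * j))"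
        by (simp add: h_def l add.assoc)
      hence "weight (y + h l) = weight (y + of_int (L [] b))" by (simp only: weight_add_even)
      moreover have "(y + h l) / 4 = (y + of_int (L [] b)) / 4 + l"
        by (simp add: h_def add_divide_distrib)
      ultimately show ?thesis
        unfolding f_def norm_fourier_scale[OF mu4, of "y + h l"] by (simp only:)
    qed
    have "inj_on h X" for X by (simp add: inj_on_def h_def)
    hence "infsum f (real_of_int ` A b) = (\<Sum>\<^sub>\<infinity>l\<in>real_of_int ` Lambda (sublabeling L [b]). f (h l))"
      unfolding image by (simp add: infsum_reindex o_def)
    also have "\<dots> = weight (y + of_int (L [] b)) *
      spectral_sum M (real_of_int ` Lambda (sublabeling L [b])) ((y + of_int (L [] b)) / 4)"
      unfolding spectral_sum_def infsum_cmult_right'[symmetric] by (rule infsum_cong) (rule step)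
    finally show ?thesis .
  qed
  ultimately show ?thesis unfolding spectral_sum_def f_def by simp
qed

lemma spectral_sum_Lambda_level:
  "parity_labeling L \<Longrightarrow> spectral_sum M (real_of_int ` Lambda L) y =
    (\<Sum>v | length v = n. path_weight L y v *
      spectral_sum M (real_of_int ` Lambda (sublabeling L v)) (node_point L y v))"
proof (induction n arbitrary: L y)
  case (Suc n)
  show ?case
    unfolding spectral_sum_Lambda_step[OF Suc.prems] sum_vertices_Suc
    by (intro sum.cong refl, subst Suc.IH)
      (simp_all add: Suc.prems parity_labeling_sublabeling sublabeling_sublabeling sum_distrib_left mult.assoc)
qed simp

text \<open>As the weights of a level add up to 1, the deficit at the root is the weighted sum of
  the deficits on that level, where only vertices on \<open>S\<close> contribute.\<close>

lemma spectral_sum_Lambda_ge_1: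
  assumes L: "parity_labeling L" and S: "finite S"
    and not_const: "\<And>p. p \<in> S \<Longrightarrow>
      \<not> ends_in 0 (path_labels L [] p) \<and> \<not> ends_in 3 (path_labels L [] p)"
    and off: "\<And>v x. (\<forall>p\<in>S. \<not> lies_on v p) \<Longrightarrow>
      spectral_sum M (real_of_int ` Lambda (sublabeling L v)) x = 1"
  shows "1 \<le> spectral_sum M (real_of_int ` Lambda L) y"
proof -
  let ?H = "\<lambda>v. spectral_sum M (real_of_int ` Lambda (sublabeling L v)) (node_point L y v)"
  have bound: "1 - spectral_sum M (real_of_int ` Lambda L) y \<le> (\<Sum>p\<in>S. path_weight L y (path_vertex p n))" for n
  proof -
    let ?V = "{v :: vertex. length v = n}"
    let ?B = "(\<lambda>p. path_vertex p n) ` S"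
    have fin: "finite ?V" using finite_lists_length_eq[of "UNIV :: bool set" n] by simp
    have B: "?B \<subseteq> ?V" by (auto simp: path_vertex_def)
    have "1 - spectral_sum M (real_of_int ` Lambda L) y = (\<Sum>v\<in>?V. path_weight L y v * (1 - ?H v))"
      by (simp add: spectral_sum_Lambda_level[OF L, of y n] path_weight_sum[OF L] right_diff_distrib sum_subtractf)
    also have "\<dots> = (\<Sum>v\<in>?B. path_weight L y v * (1 - ?H v))"
    proof (rule sum.mono_neutral_right[OF fin B], rule ballI)
      fix v assume v: "v \<in> ?V - ?B"
      hence "\<forall>p\<in>S. \<not> lies_on v p" by (auto simp: lies_on_def path_vertex_def)
      thus "path_weight L y v * (1 - ?H v) = 0" by (simp add: off)
    qed
    \<comment> \<open>Spectral sums are nonnegative, so each deficit is at most 1.\<close>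
    also have "\<dots> \<le> (\<Sum>v\<in>?B. path_weight L y v)"
      by (intro sum_mono mult_left_le) (simp_all add: spectral_sum_nonneg path_weight_nonneg)
    \<comment> \<open>Several paths may share a vertex; counting it once for each path can only
      increase the sum.\<close>
    also have "\<dots> \<le> (\<Sum>p\<in>S. path_weight L y (path_vertex p n))"
      using sum_image_le[OF S, of "path_weight L y" "\<lambda>p. path_vertex p n"] path_weight_nonneg
      by (simp add: o_def)
    finally show ?thesis .
  qed
  have "(\<lambda>n. \<Sum>p\<in>S. path_weight L y (path_vertex p n)) \<longlonglongrightarrow> (\<Sum>p\<in>S. 0)"
    using not_const by (intro tendsto_sum path_weight_tendsto_0[OF L]) blast+
  hence "1 - spectral_sum M (real_of_int ` Lambda L) y \<le> (\<Sum>p\<in>S. 0)"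
    by (rule LIMSEQ_le_const) (use bound in blast)
  thus ?thesis by simp
qed

end

theorem proposition5p3:
  fixes \<mu> :: "real measure" and L :: labeling and S :: "inf_path set"
  assumes "is_mu4 \<mu>"
    and "spectral_labeling L"
    and "finite S"
    and "\<And>p. p \<in> S \<Longrightarrow>
           \<not> ends_in 0 (path_labels L [] p) \<and> \<not> ends_in 3 (path_labels L [] p)"
    and "\<And>v. (\<forall>p\<in>S. \<not> lies_on v p) \<Longrightarrow>
           is_spectrum \<mu> (real_of_int ` Lambda (sublabeling L v))"
  shows "is_spectrum \<mu> (real_of_int ` Lambda L)"
proof -
  have L: "parity_labeling L"
    using assms(2) by (simp add: spectral_labeling_def parity_labeling_def)
  note orth = L2_orthonormal_Lambda[OF assms(1) L]
  have off: "spectral_sum \<mu> (real_of_int ` Lambda (sublabeling L v)) x = 1"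
    if "\<forall>p\<in>S. \<not> lies_on v p" for v x
    using assms(5)[OF that] unfolding is_spectrum_def L2_orthonormal_basis_def
    by (intro spectral_sum_eq_1_if_total[OF assms(1)]) simp_all
  have approx: "L2_approximable \<mu> (real_of_int ` Lambda L) expo (expo t)" for t
  proof -
    have "1 \<le> spectral_sum \<mu> (real_of_int ` Lambda L) (- t)"
      by (rule spectral_sum_Lambda_ge_1[OF assms(1) L assms(3,4) off])
    from L2_approximable_expo_if_spectral_sum[OF assms(1) orth this] show ?thesis by simp
  qed
  \<comment> \<open>The exponentials of the subtree at \<open>v\<close> are total, and by
    \<open>approx\<close> each of them lies in the closed span belonging to
    \<open>Lambda L\<close>.\<close>
  obtain v where v: "\<forall>p\<in>S. \<not> lies_on v p"
    using exists_vertex_off_paths[OF assms(3)] by blast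
  have "L2_total \<mu> (real_of_int ` Lambda (sublabeling L v)) expo"
    using assms(5)[OF v] by (simp add: is_spectrum_def L2_orthonormal_basis_def)
  hence "L2_total \<mu> (real_of_int ` Lambda L) expo"
    by (rule L2_total_trans[rotated -1]) (rule L2_function_expo[OF assms(1)] approx)+
  with orth show ?thesis by (simp add: is_spectrum_def L2_orthonormal_basis_def)
qed

end
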